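(* Let $R$, $\tilde R$ and $\hat R$ be normal Noetherian domains, and let $(\mathcal C,R)$, $(\tilde{\mathcal C},\tilde R)$ and $(\hat{\mathcal C},\hat R)$ be cluster structures of geometric type in $R$, $\tilde R$ and $\hat R$, with fixed initial extended clusters $\mathbf x_0$, $\tilde{\mathbf x}_0$ and $\hat{\mathbf x}_0$. Assume the following: 1) there are markers $\kappa$ and $\kappa'$ that make $(\mathcal C,\tilde{\mathcal C},\kappa)$ and $(\mathcal C,\hat{\mathcal C},\kappa')$ related triples, as well as a pair of complementary birational quasi-isomorphisms $\mathcal Q:(\mathcal C,R)\to(\tilde{\mathcal C},\tilde R)$ and $\mathcal Q':(\mathcal C,R)\to(\hat{\mathcal C},\hat R)$; 2) the initial extended clusters $\tilde{\mathbf x}_0$ and $\hat{\mathbf x}_0$ are admissible; 3) every $x_i\in\mathbf x_0(\kappa)$ is coprime with every $x_j\in\mathbf x_0(\kappa')$; 4) the initial extended cluster $\mathbf x_0$ is regular. Then $\mathbf x_0$ is admissible, and $\bar{\mathcal A}(\hat{\mathcal C})\subseteq\hat R$, $\bar{\mathcal A}(\tilde{\mathcal C})\subseteq\tilde R$ and $\bar{\mathcal A}(\mathcal C)\subseteq R$.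
   Context: Rings are commutative with $1$; $[a,b]=\{a,a+1,\dots,b\}$. Cluster structures. Let $\mathcal F$ be a field of rational functions in $N+M$ variables over $\mathbb Q$. An extended seed is a pair $\Sigma=(\mathbf x,B)$, where $\mathbf x=(x_1,\dots,x_{N+M})$ is a tuple of elements of $\mathcal F$ with $\mathcal F=\mathbb Q(x_1,\dots,x_{N+M})$ (the extended cluster), and $B=(b_{ij})$, $i\in[1,N]$, $j\in[1,N+M]$, is an integer matrix (the exchange matrix) whose first $N$ columns form a skew-symmetrizable matrix $B^{[1,N]}$ (there is a diagonal matrix $D$ with positive diagonal entries such that $DB^{[1,N]}$ is skew-symmetric). $x_1,\dots,x_N$ are cluster variables, $x_{N+1},\dots,x_{N+M}$ are frozen variables. The mutation of $\Sigma$ in direction $k\in[1,N]$ is the extended seed $((\mathbf x\setminus\{x_k\})\cup\{x_k'\},B')$ with $x_kx_k'=\prod_{b_{kj}>0}x_j^{b_{kj}}+\prod_{b_{kj}<0}x_j^{-b_{kj}}$, and $b'_{ij}=-b_{ij}$ if $i=k$ or $j=k$, $b'_{ij}=b_{ij}+\frac12(|b_{ik}|b_{kj}+b_{ik}|b_{kj}|)$ otherwise. The element $x_k'$ is the mutation of $x_k$. The collection $\mathcal C$ of all extended seeds obtained from an initial extended seed $\Sigma_0=(\mathbf x_0,B_0)$ by finite sequences of mutations is a cluster structure of geometric type of rank $N$, with ambient field $\mathcal F=\mathcal F_{\mathcal C}$. For an extended cluster $\mathbf x$, $\mathcal A(\mathbf x)=\mathbb Z[x_1,\dots,x_{N+M}]$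 and $\mathcal L(\mathbf x)=\mathbb Z[x_1^{\pm1},\dots,x_N^{\pm1},x_{N+1},\dots,x_{N+M}]$. The upper cluster algebra is $\bar{\mathcal A}(\mathcal C)=\bigcap_{\mathbf x\in\mathcal C}\mathcal L(\mathbf x)$ (over all extended clusters of $\mathcal C$). A cluster structure in an integral domain $R$ is a cluster structure $\mathcal C$ with an embedding $\mathcal A(\mathbf x_0)\hookrightarrow\operatorname{Frac}R$; then $\mathcal F_{\mathcal C}$ is identified with a subfield of $\operatorname{Frac}R$. A variable is regular if it lies in $R$; a set of variables (in particular an extended cluster) is regular if all its elements are. Algebra. A domain is normal if it is integrally closed in its fraction field. Two elements of $R$ are coprime if no prime ideal of $R$ of height $1$ contains both. Related triples. Let $\mathcal C$ (rank $N$, $M$ frozen variables) and $\tilde{\mathcal C}$ (rank $\tilde N$, $\tilde M$ frozen variables) be cluster structures with $\tilde N<N$, $N+M=\tilde N+\tilde M$, and fixed initial extended seeds $(\mathbf x_0,B_0)$, $(\tilde{\mathbf x}_0,\tilde B_0)$, $\mathbf x_0=(x_1,\dots,x_{N+M})$, $\tilde{\mathbf x}_0=(\tilde x_1,\dots,\tilde x_{N+M})$. A marker is a bijection $\kappa:[1,N+M]\to[1,N+M]$ with $\kappa([N+1,N+M])\subset[\tilde N+1,\tilde N+\tilde M]$; then $(\mathcal C,\tilde{\mathcal C},\kappa)$ is called a related triple. Put $\tilde{\mathcal I}(\kappa)=[\tilde N+1,\tilde N+\tilde M]\cap\kappa([1,N])$ and $\mathcal I(\kappa)=\kappa^{-1}(\tilde{\mathcal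 I}(\kappa))\subseteq[1,N]$. The marked variables are $\mathbf x_0(\kappa)=\{x_i\in\mathbf x_0: i\in\mathcal I(\kappa)\}$ in $\mathcal C$ and $\tilde{\mathbf x}_0(\kappa)=\{\tilde x_i\in\tilde{\mathbf x}_0: i\in\tilde{\mathcal I}(\kappa)\}$ in $\tilde{\mathcal C}$. An extended seed (and its extended cluster) of $\mathcal C$ is marked if it is obtained from the initial one by mutations in directions $i_1,\dots,i_m\in[1,N]\setminus\mathcal I(\kappa)$; the extended seed of $\tilde{\mathcal C}$ obtained from the initial one by mutations in directions $\kappa(i_1),\dots,\kappa(i_m)$ is related to it, and the variables $x_i\in\mathbf x$ and $\tilde x_{\kappa(i)}\in\tilde{\mathbf x}$ of related extended clusters $\mathbf x,\tilde{\mathbf x}$ are related. Quasi-isomorphisms. A quasi-isomorphism $\mathcal Q:\mathcal C\to\tilde{\mathcal C}$ is a field isomorphism $\mathcal Q:\mathcal F_{\mathcal C}\to\mathcal F_{\tilde{\mathcal C}}$ such that for every extended marked cluster $\mathbf x$ with related extended cluster $\tilde{\mathbf x}$ there are integers $\lambda_{ij}$ ($i\in[1,N+M]$, $j\in\mathcal I(\kappa)$) with $\mathcal Q(x_i)=\tilde x_{\kappa(i)}\prod_{j\in\mathcal I(\kappa)}\tilde x_{\kappa(j)}^{\lambda_{ij}}$ for $i\notin\mathcal I(\kappa)$ and $\mathcal Q(x_i)=\prod_{j\in\mathcal I(\kappa)}\tilde x_{\kappa(j)}^{\lambda_{ij}}$ for $i\in\mathcal I(\kappa)$. If $\mathcal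 C,\tilde{\mathcal C}$ are cluster structures in normal Noetherian domains $R,\tilde R$, then $\mathcal Q$ is birational if the marked variables $\mathbf x_0(\kappa)$, $\tilde{\mathbf x}_0(\kappa)$ are regular and the isomorphism $\mathcal Q:\mathcal A(\mathbf x_0)[\mathbf x_0(\kappa)^{\pm1}]\to\mathcal A(\tilde{\mathbf x}_0)[\tilde{\mathbf x}_0(\kappa)^{\pm1}]$ extends to a ring isomorphism $R[\mathbf x_0(\kappa)^{\pm1}]\to\tilde R[\tilde{\mathbf x}_0(\kappa)^{\pm1}]$ (i.e. there is such a ring isomorphism whose induced isomorphism of fraction fields restricts to $\mathcal Q$ on $\mathcal F_{\mathcal C}$), where $[\,\cdot^{\pm1}]$ denotes localization at all the listed elements. All these notions apply equally to $(\mathcal C,\hat{\mathcal C},\kappa')$ and $\mathcal Q'$, with hats in place of tildes. A pair of birational quasi-isomorphisms $\mathcal Q:(\mathcal C,R)\to(\tilde{\mathcal C},\tilde R)$, $\mathcal Q':(\mathcal C,R)\to(\hat{\mathcal C},\hat R)$ (with the same initial extended seed of $\mathcal C$) is complementary if $\mathcal I(\kappa)\cap\mathcal I(\kappa')=\emptyset$. Admissibility. A subset $A\subseteq\mathbf x_0$ of initial variables is admissible if: all variables in $A$ are regular; all cluster variables in $A$ are pairwise coprime; for each cluster variable $x\in A$, its mutation $x'$ (from the initial extended seed) is regular and coprime with $x$. Likewise for subsets of $\tilde{\mathbf x}_0$ in $(\tilde{\mathcal C},\tilde R)$ and of $\hat{\mathbf x}_0$ in $(\hat{\mathcal C},\hat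 R)$. *)

theory Defs
  imports
    "HOL-Algebra.Algebraic_Closure_Type"
    "HOL-Algebra.Generated_Fields"
    "HOL-Algebra.Ring_Divisibility"
    "HOL-Algebra.QuotRing"
    "HOL-Library.Extended_Nat"
    "HOL-Library.Poly_Mapping"
begin

text \<open>
  A domain is a subring \<open>R\<close> of a field type \<open>'a\<close> all of whose elements are quotients of
  elements of \<open>R\<close>; thus \<open>'a\<close> plays the role of \<open>Frac R\<close>, and everything that lives in
  \<open>Frac R\<close> is an element or a subset of \<open>'a\<close>.
\<close>

abbreviation ambient :: "'a::field ring"
  where "ambient \<equiv> ring_of_type_algebra"

abbreviation as_ring :: "'a::field set \<Rightarrow> 'a ring"
  where "as_ring S \<equiv> ambient\<lparr>carrier := S\<rparr>"

definition domain_with_fraction_field :: "'a::field set \<Rightarrow> bool" where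
  "domain_with_fraction_field R \<longleftrightarrow>
     subring R ambient \<and> (\<forall>z. \<exists>a\<in>R. \<exists>b\<in>R. b \<noteq> 0 \<and> z = a / b)"

definition integrally_closed :: "'a::field set \<Rightarrow> bool" where
  "integrally_closed R \<longleftrightarrow>
     (\<forall>z. (\<exists>p :: 'a Polynomial.poly. Polynomial.lead_coeff p = 1 \<and>
              (\<forall>i. Polynomial.coeff p i \<in> R) \<and> Polynomial.poly p z = 0) \<longrightarrow> z \<in> R)"

definition normal_noetherian_domain :: "'a::field set \<Rightarrow> bool" where
  "normal_noetherian_domain R \<longleftrightarrow>
     domain_with_fraction_field R \<and> noetherian_domain (as_ring R) \<and> integrally_closed R"

definition height :: "('a, 'b) ring_scheme \<Rightarrow> 'a set \<Rightarrow> enat" where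
  "height A P = Sup {enat n | n. \<exists>C :: nat \<Rightarrow> 'a set.
     (\<forall>i\<le>n. primeideal (C i) A) \<and> (\<forall>i<n. C i \<subset> C (Suc i)) \<and> C n = P}"

definition coprime_in :: "'a::field set \<Rightarrow> 'a \<Rightarrow> 'a \<Rightarrow> bool" where
  "coprime_in R x y \<longleftrightarrow> x \<in> R \<and> y \<in> R \<and>
     \<not> (\<exists>P. primeideal P (as_ring R) \<and> height (as_ring R) P = 1 \<and> x \<in> P \<and> y \<in> P)"

text \<open>
  Variables are indexed by \<open>{1..rank + frozen}\<close>, the rows of the exchange matrix by \<open>{1..rank}\<close>.
  Values of the functions \<open>variable\<close> and \<open>exch\<close> outside these ranges carry no meaning and are never
  used.
\<close>

record 'a ext_seed =
  rank :: nat
  frozen :: nat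
  variable :: "nat \<Rightarrow> 'a"
  exch :: "nat \<Rightarrow> nat \<Rightarrow> int"

definition num_vars :: "('a, 'b) ext_seed_scheme \<Rightarrow> nat" where
  "num_vars \<Sigma> = rank \<Sigma> + frozen \<Sigma>"

text \<open>
  The integer polynomials in \<open>X\<^sub>1, \<dots>, X\<^sub>n\<close> are the finitely supported maps from monomials to
  \<open>int\<close>, so the following says that evaluation at \<open>x\<close> embeds the polynomial ring
  \<open>\<int>[X\<^sub>1, \<dots>, X\<^sub>n]\<close> into the field \<open>'a\<close> (which forces characteristic zero).
\<close>

definition algebraically_independent :: "nat \<Rightarrow> (nat \<Rightarrow> 'a::field) \<Rightarrow> bool" where
  "algebraically_independent n x \<longleftrightarrow>
     (\<forall>p :: (nat \<Rightarrow>\<^sub>0 nat) \<Rightarrow>\<^sub>0 int.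
        (\<forall>m\<in>Poly_Mapping.keys p. Poly_Mapping.keys m \<subseteq> {1..n}) \<longrightarrow>
        (\<Sum>m\<in>Poly_Mapping.keys p. of_int (Poly_Mapping.lookup p m) *
            (\<Prod>i\<in>{1..n}. x i ^ Poly_Mapping.lookup m i)) = 0 \<longrightarrow>
        p = 0)"

definition skew_symmetrizable :: "nat \<Rightarrow> (nat \<Rightarrow> nat \<Rightarrow> int) \<Rightarrow> bool" where
  "skew_symmetrizable n b \<longleftrightarrow>
     (\<exists>d :: nat \<Rightarrow> real. (\<forall>i\<in>{1..n}. d i > 0) \<and>
        (\<forall>i\<in>{1..n}. \<forall>j\<in>{1..n}. d i * of_int (b i j) = - (d j * of_int (b j i))))"

text \<open>
  The ambient field of an extended seed with variables in \<open>'a = Frac R\<close> is the subfield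
  \<open>\<rat>(x\<^sub>1, \<dots>, x\<^sub>n)\<close>; algebraic independence makes it a field of rational functions in \<open>n\<close>
  variables. It may be smaller than \<open>Frac R\<close>.
\<close>

definition ambient_field :: "('a::field, 'b) ext_seed_scheme \<Rightarrow> 'a set" where
  "ambient_field \<Sigma> = generate_field ambient (variable \<Sigma> ` {1..num_vars \<Sigma>})"

definition extended_seed :: "('a::field, 'b) ext_seed_scheme \<Rightarrow> bool" where
  "extended_seed \<Sigma> \<longleftrightarrow>
     algebraically_independent (num_vars \<Sigma>) (variable \<Sigma>) \<and> skew_symmetrizable (rank \<Sigma>) (exch \<Sigma>)"

definition mutated_var :: "('a::field, 'b) ext_seed_scheme \<Rightarrow> nat \<Rightarrow> 'a" where
  "mutated_var \<Sigma> k =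
     ((\<Prod>j\<in>{j\<in>{1..num_vars \<Sigma>}. exch \<Sigma> k j > 0}. variable \<Sigma> j ^ nat (exch \<Sigma> k j)) +
      (\<Prod>j\<in>{j\<in>{1..num_vars \<Sigma>}. exch \<Sigma> k j < 0}. variable \<Sigma> j ^ nat (- exch \<Sigma> k j))) / variable \<Sigma> k"

text \<open>The integer division by two below is always exact.\<close>

definition mutated_matrix :: "(nat \<Rightarrow> nat \<Rightarrow> int) \<Rightarrow> nat \<Rightarrow> nat \<Rightarrow> nat \<Rightarrow> int" where
  "mutated_matrix b k i j =
     (if i = k \<or> j = k then - b i j
      else b i j + (\<bar>b i k\<bar> * b k j + b i k * \<bar>b k j\<bar>) div 2)"

definition mutate :: "nat \<Rightarrow> 'a::field ext_seed \<Rightarrow> 'a ext_seed" where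
  "mutate k \<Sigma> =
     \<Sigma>\<lparr>variable := (variable \<Sigma>)(k := mutated_var \<Sigma> k), exch := mutated_matrix (exch \<Sigma>) k\<rparr>"

text \<open>Mutations in directions \<open>k\<^sub>1, \<dots>, k\<^sub>m\<close>, in this order, for \<open>ks = [k\<^sub>1, \<dots>, k\<^sub>m]\<close>.\<close>

definition mutations :: "nat list \<Rightarrow> 'a::field ext_seed \<Rightarrow> 'a ext_seed" where
  "mutations ks \<Sigma> = fold mutate ks \<Sigma>"

text \<open>
  A cluster structure with a fixed initial extended seed is determined by that seed. Below,
  such structures are therefore represented by their initial extended seed.
\<close>

definition cluster_structure :: "'a::field ext_seed \<Rightarrow> 'a ext_seed set" where
  "cluster_structure \<Sigma>\<^sub>0 = {mutations ks \<Sigma>\<^sub>0 | ks. set ks \<subseteq> {1..rank \<Sigma>\<^sub>0}}"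

definition laurent_ring :: "('a::field, 'b) ext_seed_scheme \<Rightarrow> 'a set" where
  "laurent_ring \<Sigma> = generate_ring ambient
     (variable \<Sigma> ` {1..num_vars \<Sigma>} \<union> (\<lambda>i. inverse (variable \<Sigma> i)) ` {1..rank \<Sigma>})"

definition upper_cluster_algebra :: "'a::field ext_seed \<Rightarrow> 'a set" where
  "upper_cluster_algebra \<Sigma>\<^sub>0 = (\<Inter>\<Sigma>\<in>cluster_structure \<Sigma>\<^sub>0. laurent_ring \<Sigma>)"

definition marker :: "('a, 'c) ext_seed_scheme \<Rightarrow> ('b, 'd) ext_seed_scheme \<Rightarrow> (nat \<Rightarrow> nat) \<Rightarrow> bool"
  where
  "marker \<Sigma> \<Sigma>' \<kappa> \<longleftrightarrow>
     bij_betw \<kappa> {1..num_vars \<Sigma>} {1..num_vars \<Sigma>} \<and>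
     \<kappa> ` {rank \<Sigma> + 1..num_vars \<Sigma>} \<subseteq> {rank \<Sigma>' + 1..num_vars \<Sigma>'}"

definition related_triple ::
  "('a, 'c) ext_seed_scheme \<Rightarrow> ('b, 'd) ext_seed_scheme \<Rightarrow> (nat \<Rightarrow> nat) \<Rightarrow> bool" where
  "related_triple \<Sigma> \<Sigma>' \<kappa> \<longleftrightarrow>
     rank \<Sigma>' < rank \<Sigma> \<and> num_vars \<Sigma> = num_vars \<Sigma>' \<and> marker \<Sigma> \<Sigma>' \<kappa>"

definition target_marked ::
  "('a, 'c) ext_seed_scheme \<Rightarrow> ('b, 'd) ext_seed_scheme \<Rightarrow> (nat \<Rightarrow> nat) \<Rightarrow> nat set" where
  "target_marked \<Sigma> \<Sigma>' \<kappa> = {rank \<Sigma>' + 1..num_vars \<Sigma>'} \<inter> \<kappa> ` {1..rank \<Sigma>}"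

definition source_marked ::
  "('a, 'c) ext_seed_scheme \<Rightarrow> ('b, 'd) ext_seed_scheme \<Rightarrow> (nat \<Rightarrow> nat) \<Rightarrow> nat set" where
  "source_marked \<Sigma> \<Sigma>' \<kappa> = {i\<in>{1..num_vars \<Sigma>}. \<kappa> i \<in> target_marked \<Sigma> \<Sigma>' \<kappa>}"

text \<open>
  Related pairs of marked extended clusters are parametrised by the sequences \<open>ks\<close> of unmarked
  mutation directions. The integers \<open>lam i j\<close> may depend on the cluster.
\<close>

definition quasi_isomorphism ::
  "'a::field ext_seed \<Rightarrow> 'b::field ext_seed \<Rightarrow> (nat \<Rightarrow> nat) \<Rightarrow> ('a \<Rightarrow> 'b) \<Rightarrow> bool" where
  "quasi_isomorphism \<Sigma> \<Sigma>' \<kappa> Q \<longleftrightarrow>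
     Q \<in> ring_iso (as_ring (ambient_field \<Sigma>)) (as_ring (ambient_field \<Sigma>')) \<and>
     (\<forall>ks. set ks \<subseteq> {1..rank \<Sigma>} - source_marked \<Sigma> \<Sigma>' \<kappa> \<longrightarrow>
        (let x = variable (mutations ks \<Sigma>); y = variable (mutations (map \<kappa> ks) \<Sigma>');
             I = source_marked \<Sigma> \<Sigma>' \<kappa>
         in \<exists>lam :: nat \<Rightarrow> nat \<Rightarrow> int.
              (\<forall>i\<in>{1..num_vars \<Sigma>} - I. Q (x i) = y (\<kappa> i) * (\<Prod>j\<in>I. y (\<kappa> j) powi lam i j)) \<and>
              (\<forall>i\<in>I. Q (x i) = (\<Prod>j\<in>I. y (\<kappa> j) powi lam i j))))"

text \<open>The localization \<open>R[S\<^sup>\<plusminus>\<^sup>1]\<close> for a set \<open>S\<close> of nonzero elements of \<open>R\<close>, inside \<open>Frac R\<close>.\<close>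

definition localization :: "'a::field set \<Rightarrow> 'a set \<Rightarrow> 'a set" where
  "localization R S = generate_ring ambient (R \<union> inverse ` S)"

text \<open>
  An isomorphism of the localizations of \<open>R\<close> and \<open>R'\<close> is given together with the isomorphism
  \<open>\<Phi>\<close> of fraction fields that it induces.
\<close>

definition birational_quasi_isomorphism ::
  "'a::field ext_seed \<Rightarrow> 'a set \<Rightarrow> 'b::field ext_seed \<Rightarrow> 'b set \<Rightarrow> (nat \<Rightarrow> nat) \<Rightarrow> ('a \<Rightarrow> 'b) \<Rightarrow> bool"
  where
  "birational_quasi_isomorphism \<Sigma> R \<Sigma>' R' \<kappa> Q \<longleftrightarrow>
     quasi_isomorphism \<Sigma> \<Sigma>' \<kappa> Q \<and>
     variable \<Sigma> ` source_marked \<Sigma> \<Sigma>' \<kappa> \<subseteq> R \<and>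
     variable \<Sigma>' ` target_marked \<Sigma> \<Sigma>' \<kappa> \<subseteq> R' \<and>
     (\<exists>\<Phi>. \<Phi> \<in> ring_iso (ambient :: 'a ring) (ambient :: 'b ring) \<and>
        \<Phi> \<in> ring_iso (as_ring (localization R (variable \<Sigma> ` source_marked \<Sigma> \<Sigma>' \<kappa>)))
                     (as_ring (localization R' (variable \<Sigma>' ` target_marked \<Sigma> \<Sigma>' \<kappa>))) \<and>
        (\<forall>z\<in>ambient_field \<Sigma>. \<Phi> z = Q z))"

text \<open>
  A subset of the initial extended cluster is given by the set \<open>J\<close> of its indices (the variables
  of an extended seed are pairwise distinct).
\<close>

definition admissible :: "'a::field set \<Rightarrow> ('a, 'b) ext_seed_scheme \<Rightarrow> nat set \<Rightarrow> bool" where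
  "admissible R \<Sigma> J \<longleftrightarrow>
     J \<subseteq> {1..num_vars \<Sigma>} \<and>
     (\<forall>i\<in>J. variable \<Sigma> i \<in> R) \<and>
     (\<forall>i\<in>J \<inter> {1..rank \<Sigma>}. \<forall>j\<in>J \<inter> {1..rank \<Sigma>}. i \<noteq> j \<longrightarrow> coprime_in R (variable \<Sigma> i) (variable \<Sigma> j)) \<and>
     (\<forall>i\<in>J \<inter> {1..rank \<Sigma>}. mutated_var \<Sigma> i \<in> R \<and> coprime_in R (mutated_var \<Sigma> i) (variable \<Sigma> i))"

end

theory Submission
  imports Defs
begin

text \<open>
  A normal Noetherian domain is the intersection of its localizations at the primes of height one,
  so regularity and coprimality can be tested at one such prime \<open>P\<close> at a time. For the upper cluster
  algebra of an admissible seed, the initial cluster or an adjacent one consists of units at \<open>P\<close>.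
  For the admissibility of \<open>x\<^sub>0\<close>, coprimality between the two sets of marked variables shows that
  \<open>P\<close> avoids the marked variables of one of the two quasi-isomorphisms; it then survives in the corresponding
  localization and is carried to a height one prime of the target ring, where admissibility holds.
\<close>

text \<open>Regularity of the mutations x' of the variables in x_0 is not among the hypotheses. A
  single quasi-isomorphism gives it only up to denominators in its marked variables, that is, in a
  localization of R. This settles regularity only at primes avoiding these variables, hence the need
  for a second quasi-isomorphism and for an argument prime by prime. Moreover, related variables
  correspond only up to Laurent monomials in the marked variables of the target. These are frozen
  there, so mutations leave them alone, and they are units of the localization, so they do not
  affect membership in a prime that survives in it. The transport of primes is therefore developed
  without clusters, for two domains that become isomorphic after some of their elements are
  inverted.\<close>

lemma ambient_simps [simp]:
  "carrier ambient = UNIV"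
  "x \<otimes>\<^bsub>ambient\<^esub> y = x * y"
  "x \<oplus>\<^bsub>ambient\<^esub> y = x + y"
  "\<one>\<^bsub>ambient\<^esub> = 1"
  "\<zero>\<^bsub>ambient\<^esub> = 0"
  by (simp_all add: ring_of_type_algebra_def)

lemma ring_ambient: "ring (ambient :: 'a::field ring)"
  by (rule ring_from_type_algebra)

lemma ambient_minus [simp]: "\<ominus>\<^bsub>ambient\<^esub> x = - (x :: 'a::field)"
  by (rule abelian_group.minus_equality[OF ring.is_abelian_group[OF ring_ambient]]) simp_all

lemma field_ambient: "Ring.field (ambient :: 'a::field ring)"
  by (rule field_from_type_algebra)

lemma ambient_inv [simp]: "x \<noteq> 0 \<Longrightarrow> inv\<^bsub>ambient\<^esub> x = inverse (x :: 'a::field)"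
  by (rule comm_monoid.comm_inv_char)
     (auto simp: cring.axioms(2)[OF cring_from_type_algebra])

section \<open>Closure properties of subrings of a field\<close>

locale field_subring =
  fixes R :: "'a::field set"
  assumes subring: "subring R ambient"
begin

lemma one_closed [simp]: "1 \<in> R"
  and zero_closed [simp]: "0 \<in> R"
  and minus_closed: "x \<in> R \<Longrightarrow> - x \<in> R"
  and mult_closed: "x \<in> R \<Longrightarrow> y \<in> R \<Longrightarrow> x * y \<in> R"
  and add_closed: "x \<in> R \<Longrightarrow> y \<in> R \<Longrightarrow> x + y \<in> R"
  using subringE[OF subring] by simp_all

lemma power_closed: "x \<in> R \<Longrightarrow> x ^ n \<in> R"
  by (induction n) (simp_all add: mult_closed)

lemma prod_closed: "(\<And>i. i \<in> I \<Longrightarrow> f i \<in> R) \<Longrightarrow> prod f I \<in> R"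
  by (induction I rule: infinite_finite_induct) (simp_all add: mult_closed)

lemma sum_closed: "(\<And>i. i \<in> I \<Longrightarrow> f i \<in> R) \<Longrightarrow> sum f I \<in> R"
  by (induction I rule: infinite_finite_induct) (simp_all add: add_closed)

lemma cring_as_ring: "cring (as_ring R)"
  using cring.subcringI'[OF cring_from_type_algebra subring]
    ring.subcring_iff[OF ring_ambient subringE(1)[OF subring]] by blast

lemma idealI':
  assumes "I \<subseteq> R" "0 \<in> I" "\<And>x y. x \<in> I \<Longrightarrow> y \<in> I \<Longrightarrow> x + y \<in> I"
    "\<And>r x. r \<in> R \<Longrightarrow> x \<in> I \<Longrightarrow> r * x \<in> I"
  shows "ideal I (as_ring R)"
proof (rule idealI)
  show "ring (as_ring R)"
    using cring_as_ring by (rule cring.axioms(1))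
  interpret A: cring "as_ring R" by (rule cring_as_ring)
  show "subgroup I (add_monoid (as_ring R))"
  proof (rule group.subgroupI[OF A.a_group])
    fix a assume a: "a \<in> I"
    have "inv\<^bsub>add_monoid (as_ring R)\<^esub> a = - a"
    proof -
      have "\<ominus>\<^bsub>as_ring R\<^esub> a = - a"
        using a assms(1) minus_closed by (intro A.minus_equality) auto
      then show ?thesis by (simp add: a_inv_def)
    qed
    moreover have "- 1 * a \<in> I" using assms(4)[OF minus_closed a] one_closed by blast
    ultimately show "inv\<^bsub>add_monoid (as_ring R)\<^esub> a \<in> I" by simp
  qed (use assms in auto)
  fix a x assume "a \<in> I" "x \<in> carrier (as_ring R)"
  then have "x * a \<in> I" using assms(4) by simp
  then show "x \<otimes>\<^bsub>as_ring R\<^esub> a \<in> I" "a \<otimes>\<^bsub>as_ring R\<^esub> x \<in> I"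
    by (simp_all add: mult.commute)
qed

end

subsection \<open>Height one primes of normal domains\<close>

text \<open>Phrased with the type class operations, so that automation does not have to see through
  the record \<open>as_ring R\<close>; \<open>primeideal_iff\<close> is the link to
  HOL-Algebra.\<close>

definition prime_ideal_in :: "'a::field set \<Rightarrow> 'a set \<Rightarrow> bool" where
  "prime_ideal_in R P \<longleftrightarrow> P \<subseteq> R \<and> 0 \<in> P \<and> 1 \<notin> P \<and> (\<forall>x\<in>P. \<forall>y\<in>P. x + y \<in> P) \<and>
     (\<forall>r\<in>R. \<forall>x\<in>P. r * x \<in> P) \<and> (\<forall>a\<in>R. \<forall>b\<in>R. a * b \<in> P \<longrightarrow> a \<in> P \<or> b \<in> P)"

text \<open>The zero ideal of a domain is prime, so height one amounts to being minimal among the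
  nonzero primes. This avoids the supremum over chains; \<open>height_eq_1_iff\<close> justifies
  it.\<close>

definition height_one_prime :: "'a::field set \<Rightarrow> 'a set \<Rightarrow> bool" where
  "height_one_prime R P \<longleftrightarrow> prime_ideal_in R P \<and> P \<noteq> {0} \<and>
     (\<forall>Q. prime_ideal_in R Q \<and> Q \<subset> P \<longrightarrow> Q = {0})"

context field_subring
begin

lemma primeideal_iff: "primeideal P (as_ring R) \<longleftrightarrow> prime_ideal_in R P"
proof
  assume "primeideal P (as_ring R)"
  then interpret P: primeideal P "as_ring R" .
  have "1 \<notin> P" using P.I_notcarr P.one_imp_carrier by auto
  then show "prime_ideal_in R P"
    unfolding prime_ideal_in_def
    using P.a_subset additive_subgroup.zero_closed[OF P.is_additive_subgroup]
      additive_subgroup.a_closed[OF P.is_additive_subgroup] P.I_l_closed P.I_prime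
    by (auto simp: subset_iff)
next
  assume P: "prime_ideal_in R P"
  show "primeideal P (as_ring R)"
  proof (rule primeidealI)
    show "ideal P (as_ring R)"
      using P by (intro idealI') (auto simp: prime_ideal_in_def)
    show "cring (as_ring R)" by (rule cring_as_ring)
  qed (use P in \<open>auto simp: prime_ideal_in_def\<close>)
qed

lemma zero_prime: "prime_ideal_in R {0}"
  by (auto simp: prime_ideal_in_def)

lemma height_eq_1_iff:
  "primeideal P (as_ring R) \<and> height (as_ring R) P = 1 \<longleftrightarrow> height_one_prime R P"
proof (cases "prime_ideal_in R P")
  case P: True
  define N where "N = {enat n | n. \<exists>C :: nat \<Rightarrow> 'a set.
     (\<forall>i\<le>n. prime_ideal_in R (C i)) \<and> (\<forall>i<n. C i \<subset> C (Suc i)) \<and> C n = P}"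
  have height: "height (as_ring R) P = Sup N"
    by (simp add: height_def N_def primeideal_iff)
  have "Sup N = 1 \<longleftrightarrow> height_one_prime R P"
  proof
    assume S: "Sup N = 1"
    have le1: "n \<le> 1" if "enat n \<in> N" for n
      using Sup_upper[OF that] S by (simp add: one_enat_def)
    show "height_one_prime R P"
      unfolding height_one_prime_def
    proof (intro conjI allI impI P notI; (elim conjE)?)
      assume P0: "P = {0}"
      have "n = 0" if "enat n \<in> N" for n
      proof (rule ccontr)
        assume "n \<noteq> 0"
        with that obtain C k where C: "\<forall>i\<le>n. prime_ideal_in R (C i)" "\<forall>i<n. C i \<subset> C (Suc i)"
          "C n = P" "n = Suc k" unfolding N_def using not0_implies_Suc[of n] by auto
        then have "C k \<subset> {0}" "0 \<in> C k" using P0 by (auto simp: prime_ideal_in_def)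
        then show False by auto
      qed
      then have "N \<subseteq> {0}" by (auto simp: N_def zero_enat_def)
      then have "Sup N \<le> 0" by (intro Sup_least) auto
      with S show False by simp
    next
      fix Q assume Q: "prime_ideal_in R Q" "Q \<subset> P"
      show "Q = {0}"
      proof (rule ccontr)
        assume "Q \<noteq> {0}"
        then have "{0} \<subset> Q" using Q by (auto simp: prime_ideal_in_def)
        \<comment> \<open>The chain {0}, Q, P has length 2, while the supremum is 1.\<close>
        then have "enat 2 \<in> N"
          unfolding N_def using P Q zero_prime
          by (intro CollectI exI[of _ 2] conjI refl
                exI[of _ "\<lambda>i::nat. if i = 0 then {0} else if i = 1 then Q else P"])
             (auto simp: less_Suc_eq numeral_2_eq_2)
        from le1[OF this] show False by simp
      qed
    qed
  next
    assume h: "height_one_prime R P"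
    have "{0} \<subset> P" using h by (auto simp: height_one_prime_def prime_ideal_in_def)
    then have "1 \<in> N"
      unfolding N_def using P zero_prime
      by (intro CollectI exI[of _ 1] conjI exI[of _ "\<lambda>i::nat. if i = 0 then {0} else P"])
         (auto simp: one_enat_def)
    moreover have "n \<le> 1" if "n \<in> N" for n
    proof (rule ccontr)
      assume "\<not> n \<le> 1"
      with that obtain C m where m: "n = enat m" "\<forall>i\<le>m. prime_ideal_in R (C i)"
        "\<forall>i<m. C i \<subset> C (Suc i)" "C m = P" "m > 1"
        by (auto simp: N_def one_enat_def)
      \<comment> \<open>In a chain of length at least 2 the last member before P is a prime strictly
        below P, hence {0}, and leaves no room for its own predecessor.\<close>
      have "m = Suc (Suc (m - 2))" using m(5) by simp
      then obtain k where k: "m = Suc (Suc k)" ..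
      have "prime_ideal_in R (C (Suc k))" "C (Suc k) \<subset> P" using m k by auto
      then have "C (Suc k) = {0}" using h unfolding height_one_prime_def by blast
      moreover have "C k \<subset> C (Suc k)" "0 \<in> C k" using m k by (auto simp: prime_ideal_in_def)
      ultimately show False by auto
    qed
    ultimately show "Sup N = 1" by (meson Sup_eqI)
  qed
  then show ?thesis using P height by (simp add: primeideal_iff)
qed (simp add: primeideal_iff height_one_prime_def)

lemma coprime_in_iff:
  "coprime_in R x y \<longleftrightarrow> x \<in> R \<and> y \<in> R \<and> \<not> (\<exists>P. height_one_prime R P \<and> x \<in> P \<and> y \<in> P)"
  unfolding coprime_in_def height_eq_1_iff[symmetric] by blast

end

text \<open>If 0 lies in P then s is nonzero and z is the fraction (s * z) / s; quantifying over the
  denominator alone avoids division.\<close>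

definition local_ring_at :: "'a::field set \<Rightarrow> 'a set \<Rightarrow> 'a set" where
  "local_ring_at R P = {z. \<exists>s\<in>R - P. s * z \<in> R}"

locale prime_of_subring = field_subring +
  fixes P
  assumes prime: "prime_ideal_in R P"
begin

lemma P_subset: "P \<subseteq> R" and P_zero: "0 \<in> P" and P_one: "1 \<notin> P"
  and P_add: "x \<in> P \<Longrightarrow> y \<in> P \<Longrightarrow> x + y \<in> P"
  and P_mult: "r \<in> R \<Longrightarrow> x \<in> P \<Longrightarrow> r * x \<in> P"
  and P_prime: "a \<in> R \<Longrightarrow> b \<in> R \<Longrightarrow> a * b \<in> P \<Longrightarrow> a \<in> P \<or> b \<in> P"
  using prime by (auto simp: prime_ideal_in_def)

lemma subset_local_ring: "R \<subseteq> local_ring_at R P"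
proof
  fix x assume "x \<in> R"
  then show "x \<in> local_ring_at R P"
    using P_one unfolding local_ring_at_def by (intro CollectI bexI[of _ 1]) auto
qed

lemma inverse_in_local_ring: "x \<in> R - P \<Longrightarrow> inverse x \<in> local_ring_at R P"
  using P_zero unfolding local_ring_at_def by (cases "x = 0") (auto intro!: bexI[of _ x])

lemma local_ring_subring: "subring (local_ring_at R P) ambient"
proof (rule ring.subringI[OF ring_ambient])
  show "\<one>\<^bsub>ambient\<^esub> \<in> local_ring_at R P"
    using subset_local_ring by auto
  fix x assume "x \<in> local_ring_at R P"
  then obtain s where s: "s \<in> R - P" "s * x \<in> R" by (auto simp: local_ring_at_def)
  then show "\<ominus>\<^bsub>ambient\<^esub> x \<in> local_ring_at R P"
    using minus_closed[of "s * x"] by (auto simp: local_ring_at_def intro!: bexI[of _ s])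
  fix y assume "y \<in> local_ring_at R P"
  then obtain t where t: "t \<in> R - P" "t * y \<in> R" by (auto simp: local_ring_at_def)
  have st: "s * t \<in> R - P" using s t P_prime mult_closed by blast
  have "(s * t) * (x * y) = (s * x) * (t * y)" by simp
  then have "(s * t) * (x * y) \<in> R" using s t mult_closed by metis
  then show "x \<otimes>\<^bsub>ambient\<^esub> y \<in> local_ring_at R P"
    using st by (auto simp: local_ring_at_def)
  have "(s * t) * (x + y) = t * (s * x) + s * (t * y)" by (simp add: algebra_simps)
  then have "(s * t) * (x + y) \<in> R" using s t mult_closed add_closed by simp
  then show "x \<oplus>\<^bsub>ambient\<^esub> y \<in> local_ring_at R P"
    using st by (auto simp: local_ring_at_def)
qed simp

lemma generate_subset_local_ring:
  "H \<subseteq> local_ring_at R P \<Longrightarrow> generate_ring ambient H \<subseteq> local_ring_at R P"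
  using ring.generate_ring_min_subring1[OF ring_ambient _ local_ring_subring] by simp

end

section \<open>Normal Noetherian domains as intersections of local rings\<close>

locale normal_domain = field_subring +
  assumes normal: "normal_noetherian_domain R"
begin

lemma fraction: obtains a b where "a \<in> R" "b \<in> R" "b \<noteq> 0" "z = a / b"
  using normal unfolding normal_noetherian_domain_def domain_with_fraction_field_def by meson

lemma noetherian: "noetherian_ring (as_ring R)"
  using normal by (auto simp: normal_noetherian_domain_def noetherian_domain_def)

lemma integrally_closedD:
  assumes "Polynomial.lead_coeff p = 1" "\<And>i. Polynomial.coeff p i \<in> R" "Polynomial.poly p z = 0"
  shows "z \<in> R"
  using normal assms unfolding normal_noetherian_domain_def integrally_closed_def by blast

text \<open>
  The powers of \<open>w\<close> lie in the finitely generated \<open>R\<close>-module \<open>(1/q)R\<close>, so \<open>w\<close> is integral.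
\<close>

lemma completely_integrally_closed:
  assumes q: "q \<noteq> 0" and powers: "\<And>n. q * w ^ n \<in> R"
  shows "w \<in> R"
proof -
  \<comment> \<open>The module spanned by the first n powers of w need not lie in R. Multiplied by q
    it becomes an ideal of R, to which the ascending chain condition applies.\<close>
  define J where "J n = {\<Sum>i<n. r i * (q * w ^ i) | r. \<forall>i. r i \<in> R}" for n
  have ideal: "ideal (J n) (as_ring R)" for n
  proof (rule idealI')
    show "J n \<subseteq> R"
      using powers mult_closed by (auto simp: J_def intro!: sum_closed)
    show "0 \<in> J n"
      by (auto simp: J_def intro!: exI[of _ "\<lambda>_. 0"])
    fix x y assume "x \<in> J n" "y \<in> J n"
    then obtain r s where r: "x = (\<Sum>i<n. r i * (q * w ^ i))" "\<forall>i. r i \<in> R"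
      and s: "y = (\<Sum>i<n. s i * (q * w ^ i))" "\<forall>i. s i \<in> R" by (auto simp: J_def)
    have "x + y = (\<Sum>i<n. (r i + s i) * (q * w ^ i))"
      unfolding r s by (simp add: sum.distrib distrib_right)
    then show "x + y \<in> J n"
      unfolding J_def using r s add_closed by (intro CollectI exI[of _ "\<lambda>i. r i + s i"]) auto
  next
    fix a x assume "a \<in> R" "x \<in> J n"
    then obtain r where r: "x = (\<Sum>i<n. r i * (q * w ^ i))" "\<forall>i. r i \<in> R" by (auto simp: J_def)
    have "a * x = (\<Sum>i<n. (a * r i) * (q * w ^ i))"
      unfolding r by (simp add: sum_distrib_left mult.assoc)
    then show "a * x \<in> J n"
      unfolding J_def using r \<open>a \<in> R\<close> mult_closed by (intro CollectI exI[of _ "\<lambda>i. a * r i"]) auto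
  qed
  have step: "J n \<subseteq> J (Suc n)" for n
  proof
    fix x assume "x \<in> J n"
    then obtain r where r: "x = (\<Sum>i<n. r i * (q * w ^ i))" "\<forall>i. r i \<in> R" by (auto simp: J_def)
    then have "x = (\<Sum>i<Suc n. (r(n := 0)) i * (q * w ^ i))" by simp
    moreover have "\<forall>i. (r(n := 0)) i \<in> R" using r by simp
    ultimately show "x \<in> J (Suc n)"
      unfolding J_def by (intro CollectI exI[of _ "r(n := 0)"] conjI)
  qed
  have "subset.chain {I. ideal I (as_ring R)} (range J)"
    unfolding subset_chain_def
  proof (intro conjI ballI)
    fix A B assume "A \<in> range J" "B \<in> range J"
    then obtain i j where "A = J i" "B = J j" by auto
    then show "A \<subseteq> B \<or> B \<subseteq> A"
      using lift_Suc_mono_le[of J i j, OF step] lift_Suc_mono_le[of J j i, OF step]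
      by (cases "i \<le> j") auto
  qed (use ideal in auto)
  from noetherian_ring.ideal_chain_is_trivial[OF noetherian _ this]
  obtain n where n: "\<Union> (range J) = J n" by auto
  \<comment> \<open>The chain stops at n, so the new generator \<open>q * w ^ n\<close> of
    \<open>J (Suc n)\<close> is already in \<open>J n\<close>. Cancelling q yields a monic equation
    for w.\<close>
  have "q * w ^ n = (\<Sum>i<Suc n. (if i = n then 1 else 0) * (q * w ^ i))"
    by simp
  moreover have "\<forall>i. (if i = n then 1 else 0) \<in> R" by simp
  ultimately have "q * w ^ n \<in> J (Suc n)"
    unfolding J_def by (intro CollectI exI[of _ "\<lambda>i. if i = n then 1 else 0"] conjI)
  then have "q * w ^ n \<in> J n" using n by blast
  then obtain r where r: "q * w ^ n = (\<Sum>i<n. r i * (q * w ^ i))" "\<forall>i. r i \<in> R" by (auto simp: J_def)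
  have "q * w ^ n = q * (\<Sum>i<n. r i * w ^ i)"
    unfolding r by (simp add: sum_distrib_left mult_ac)
  then have wn: "w ^ n = (\<Sum>i<n. r i * w ^ i)" using q by simp
  define p where "p = Polynomial.monom 1 n - (\<Sum>i<n. Polynomial.monom (r i) i)"
  have coeff_p: "Polynomial.coeff p k = (if k = n then 1 else if k < n then - r k else 0)" for k
    unfolding p_def by (simp add: coeff_sum Polynomial.coeff_monom sum.delta)
  have "Polynomial.degree p = n"
    by (rule antisym, rule degree_le) (simp_all add: coeff_p le_degree)
  then have "Polynomial.lead_coeff p = 1" by (simp add: coeff_p)
  moreover have "Polynomial.coeff p k \<in> R" for k
    using r by (simp add: coeff_p minus_closed)
  moreover have "Polynomial.poly p w = 0"
    by (simp add: p_def poly_sum poly_monom wn)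
  ultimately show ?thesis by (rule integrally_closedD)
qed

text \<open>
  An ideal maximal among the \<open>{r \<in> R. r * w \<in> R}\<close> with \<open>w \<notin> R\<close> is prime. It has height one: a prime
  \<open>Q\<close> strictly below it is stable under multiplication by \<open>w\<close>, so a nonzero \<open>q \<in> Q\<close> would have all
  \<open>q * w ^ n\<close> in \<open>R\<close>.
\<close>

lemma in_all_local_rings:
  assumes local: "\<And>P. height_one_prime R P \<Longrightarrow> z \<in> local_ring_at R P"
  shows "z \<in> R"
proof (rule ccontr)
  assume z: "z \<notin> R"
  define D where "D w = {r \<in> R. r * w \<in> R}" for w
  \<comment> \<open>Only ideals above \<open>D z\<close> compete, so the maximal one contains every
    denominator of z. Once it is known to be a height one prime, this contradicts the assumption on
    z.\<close>
  define \<F> where "\<F> = {D w | w. w \<notin> R \<and> D z \<subseteq> D w}"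
  have ideal_D: "ideal (D w) (as_ring R)" for w
    by (rule idealI') (auto simp: D_def mult_closed add_closed distrib_right mult.assoc)
  have "\<F> \<noteq> {}" using z by (auto simp: \<F>_def)
  have "\<exists>M\<in>\<F>. \<forall>N\<in>\<F>. M \<subseteq> N \<longrightarrow> N = M"
  proof (rule subset_Zorn_nonempty[OF \<open>\<F> \<noteq> {}\<close>])
    fix C assume C: "C \<noteq> {}" "subset.chain \<F> C"
    have "subset.chain {I. ideal I (as_ring R)} C"
      using C(2) ideal_D by (auto simp: subset.chain_def \<F>_def)
    from noetherian_ring.ideal_chain_is_trivial[OF noetherian C(1) this]
    show "\<Union>C \<in> \<F>" using C(2) by (auto simp: subset.chain_def)
  qed
  then obtain M where M: "M \<in> \<F>" "\<And>N. N \<in> \<F> \<Longrightarrow> M \<subseteq> N \<Longrightarrow> N = M" by blast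
  then obtain w where w: "w \<notin> R" "D z \<subseteq> D w" "M = D w" by (auto simp: \<F>_def)
  have max: "D v = D w" if "v \<notin> R" "D w \<subseteq> D v" for v
  proof -
    have "D v \<in> \<F>" using that w by (auto simp: \<F>_def)
    then show ?thesis using M(2) that w by simp
  qed
  define P where "P = D w"
  have prime: "prime_ideal_in R P"
    unfolding prime_ideal_in_def
  proof (intro conjI ballI impI)
    fix a b assume a: "a \<in> R" and b: "b \<in> R" and ab: "a * b \<in> P"
    show "a \<in> P \<or> b \<in> P"
    proof (cases "a * w \<in> R")
      case True
      then show ?thesis using a by (simp add: P_def D_def)
    next
      case False
      \<comment> \<open>By maximality \<open>a * w\<close> has no more denominators than w, and b is
        one of them.\<close>
      have "D w \<subseteq> D (a * w)"
        using mult_closed[OF a] by (auto simp: D_def mult.left_commute[of _ a])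
      then have "D (a * w) = D w" using max False by blast
      moreover have "b \<in> D (a * w)" using ab b by (simp add: P_def D_def mult_ac)
      ultimately show ?thesis by (simp add: P_def)
    qed
  qed (use w in \<open>auto simp: P_def D_def mult_closed add_closed distrib_right mult.assoc\<close>)
  interpret P: prime_of_subring R P by unfold_locales (rule prime)
  have stable: False if q: "q \<in> N" "q \<noteq> 0" "N \<subseteq> P" and N: "\<And>x. x \<in> N \<Longrightarrow> x * w \<in> N" for q N
  proof -
    have "q * w ^ n \<in> N" for n
      by (induction n) (use q N in \<open>simp_all add: mult.assoc[symmetric] power_Suc2 del: power_Suc\<close>)
    then have "q * w ^ n \<in> R" for n using q P.P_subset by blast
    then show False using completely_integrally_closed q w by blast
  qed
  obtain a b where ab: "a \<in> R" "b \<in> R" "b \<noteq> 0" "w = a / b" by (rule fraction)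
  then have b: "b \<in> P" by (simp add: P_def D_def)
  \<comment> \<open>Since \<open>p * w\<close> is an element of R outside P, it is a unit at P, and
    p turns out to generate P locally: x = p * (x * w) / (p * w) for x in P.\<close>
  obtain p where p: "p \<in> P" "p * w \<notin> P" using stable[OF b \<open>b \<noteq> 0\<close>] by blast
  have PwR: "x * w \<in> R" if "x \<in> P" for x using that by (simp add: P_def D_def)
  have "height_one_prime R P"
    unfolding height_one_prime_def
  proof (intro conjI allI impI prime; (elim conjE)?)
    show "P \<noteq> {0}" using b ab by auto
    fix Q assume Q: "prime_ideal_in R Q" and QP: "Q \<subset> P"
    interpret Q: prime_of_subring R Q by unfold_locales (rule Q)
    have pw: "p * w \<in> R" "p * w \<notin> Q" using PwR p QP by auto
    \<comment> \<open>This is used twice, with \<open>p * w\<close> outside Q. If p were in Q,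
      taking x in P would put all of P into Q. With p outside Q, taking x in Q gives that
      \<open>x * w\<close> is in Q.\<close>
    have swap: "(p * w) * x = p * (x * w)" for x by (simp add: mult_ac)
    have pQ: "p \<notin> Q"
    proof
      assume pQ: "p \<in> Q"
      have "x \<in> Q" if "x \<in> P" for x
      proof -
        have "(p * w) * x \<in> Q"
          unfolding swap using Q.P_mult[OF PwR[OF that] pQ] by (simp add: mult.commute)
        then show ?thesis using Q.P_prime pw that P.P_subset by blast
      qed
      then show False using QP by blast
    qed
    have "x * w \<in> Q" if x: "x \<in> Q" for x
    proof -
      have "p * (x * w) \<in> Q" using Q.P_mult[OF pw(1) x] by (simp only: swap)
      then show ?thesis using Q.P_prime[of p "x * w"] pQ p P.P_subset PwR x QP by blast
    qed
    then have "q = 0" if "q \<in> Q" for q using stable[of q Q] that QP by blast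
    then show "Q = {0}" using Q.P_zero by auto
  qed
  from local[OF this] obtain s where "s \<in> R" "s \<notin> P" "s * z \<in> R" by (auto simp: local_ring_at_def)
  then show False using w by (auto simp: P_def D_def)
qed

end

subsection \<open>Transport of primes between localizations\<close>

definition units_of_subring :: "'a::field set \<Rightarrow> 'a set" where
  "units_of_subring A = {u. u \<noteq> 0 \<and> u \<in> A \<and> inverse u \<in> A}"

context field_subring
begin

lemma units_mult: "u \<in> units_of_subring R \<Longrightarrow> v \<in> units_of_subring R \<Longrightarrow> u * v \<in> units_of_subring R"
  by (auto simp: units_of_subring_def mult_closed)

lemma units_powi: "u \<in> units_of_subring R \<Longrightarrow> u powi n \<in> units_of_subring R"
  by (auto simp: units_of_subring_def power_int_def power_closed power_inverse[symmetric])

lemma units_prod: "(\<And>i. i \<in> I \<Longrightarrow> f i \<in> units_of_subring R) \<Longrightarrow> prod f I \<in> units_of_subring R"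
  by (induction I rule: infinite_finite_induct) (auto simp: units_mult, auto simp: units_of_subring_def)

end

text \<open>An abstract form of the localization of R at a set of elements: every element of A has a
  denominator in R that is invertible in A. The inverted set itself does not appear, which keeps the
  theory symmetric under isomorphism.\<close>

locale fraction_extension = field_subring +
  fixes A
  assumes subring_A: "subring A ambient"
    and R_subset_A: "R \<subseteq> A"
    and denominator: "z \<in> A \<Longrightarrow> \<exists>m\<in>R \<inter> units_of_subring A. m * z \<in> R"

sublocale fraction_extension \<subseteq> A: field_subring A
  by (rule field_subring.intro) (rule subring_A)

text \<open>The elements with a denominator of the required kind form a subring, since denominators
  can be multiplied; it contains R and the inverses of S, hence all they generate.\<close>

lemma fraction_extension_localization:
  assumes R: "subring R ambient" and S: "S \<subseteq> R" "0 \<notin> S"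
  shows "fraction_extension R (localization R S)"
proof -
  interpret field_subring R by (rule field_subring.intro) (rule R)
  let ?A = "localization R S"
  have A: "subring ?A ambient"
    unfolding localization_def by (rule ring.generate_ring_is_subring[OF ring_ambient]) simp
  interpret A: field_subring ?A by (rule field_subring.intro) (rule A)
  have incl: "R \<union> inverse ` S \<subseteq> ?A"
    unfolding localization_def by (auto intro: generate_ring.incl)
  let ?U = "R \<inter> units_of_subring ?A"
  define D where "D = {z. \<exists>m\<in>?U. m * z \<in> R}"
  have U: "m * n \<in> ?U" if "m \<in> ?U" "n \<in> ?U" for m n
    using that A.units_mult mult_closed by auto
  have one: "1 \<in> ?U" by (simp add: units_of_subring_def)
  have "subring D ambient"
  proof (rule ring.subringI[OF ring_ambient])
    show "\<one>\<^bsub>ambient\<^esub> \<in> D"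
      using one unfolding D_def by (intro CollectI bexI[of _ 1]) simp_all
    fix x assume "x \<in> D"
    then obtain s where s: "s \<in> ?U" "s * x \<in> R" by (auto simp: D_def)
    then show "\<ominus>\<^bsub>ambient\<^esub> x \<in> D"
      using minus_closed[of "s * x"] by (auto simp: D_def intro!: bexI[of _ s])
    fix y assume "y \<in> D"
    then obtain t where t: "t \<in> ?U" "t * y \<in> R" by (auto simp: D_def)
    have "(s * t) * (x * y) = (s * x) * (t * y)" by simp
    then have "(s * t) * (x * y) \<in> R" using s t mult_closed by metis
    then show "x \<otimes>\<^bsub>ambient\<^esub> y \<in> D" using U[OF s(1) t(1)] unfolding D_def by auto
    have "(s * t) * (x + y) = t * (s * x) + s * (t * y)" by (simp add: algebra_simps)
    then have "(s * t) * (x + y) \<in> R" using s t mult_closed add_closed by simp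
    then show "x \<oplus>\<^bsub>ambient\<^esub> y \<in> D" using U[OF s(1) t(1)] unfolding D_def by auto
  qed simp
  moreover have "R \<union> inverse ` S \<subseteq> D"
  proof
    fix z assume "z \<in> R \<union> inverse ` S"
    then show "z \<in> D"
    proof
      assume "z \<in> R"
      then show ?thesis using one unfolding D_def by (intro CollectI bexI[of _ 1]) auto
    next
      assume "z \<in> inverse ` S"
      then obtain s where s: "s \<in> S" "z = inverse s" "s \<noteq> 0" using S by auto
      then have "s \<in> ?U" using incl S by (auto simp: units_of_subring_def)
      then show ?thesis using s unfolding D_def by (intro CollectI bexI[of _ s]) auto
    qed
  qed
  ultimately have "?A \<subseteq> D"
    unfolding localization_def by (intro ring.generate_ring_min_subring1[OF ring_ambient]) auto
  then show ?thesis
    using incl A field_subring_axioms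
    by (intro fraction_extension.intro fraction_extension_axioms.intro) (auto simp: D_def)
qed

lemma localization_units:
  assumes "s \<in> S" "S \<subseteq> R" "0 \<notin> S"
  shows "s \<in> units_of_subring (localization R S)"
proof -
  have "R \<union> inverse ` S \<subseteq> localization R S"
    unfolding localization_def by (auto intro: generate_ring.incl)
  then show ?thesis using assms by (auto simp: units_of_subring_def)
qed

text \<open>For an ideal P and a fraction extension A this is the ideal P A. A common denominator
  replaces the sums of products.\<close>

definition extended_ideal :: "'a::field set \<Rightarrow> 'a set \<Rightarrow> 'a set \<Rightarrow> 'a set" where
  "extended_ideal R A P = {z. \<exists>m\<in>R \<inter> units_of_subring A. m * z \<in> P}"

text \<open>These are the primes of R that stay proper in A. Extension and contraction match them
  with the primes of A.\<close>

locale unit_free_prime = fraction_extension + prime_of_subring +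
  assumes unit_free: "P \<inter> units_of_subring A = {}"
begin

lemma extended_contract: "r \<in> R \<Longrightarrow> r \<in> extended_ideal R A P \<Longrightarrow> r \<in> P"
  using P_prime unit_free by (fastforce simp: extended_ideal_def)

lemma P_extended: "P \<subseteq> extended_ideal R A P"
  by (auto simp: extended_ideal_def units_of_subring_def intro!: bexI[of _ 1])

lemma extended_one: "1 \<notin> extended_ideal R A P"
  using extended_contract P_one by auto

lemma extended_add:
  assumes "x \<in> extended_ideal R A P" "y \<in> extended_ideal R A P"
  shows "x + y \<in> extended_ideal R A P"
proof -
  obtain m n where m: "m \<in> R" "m \<in> units_of_subring A" "m * x \<in> P"
    and n: "n \<in> R" "n \<in> units_of_subring A" "n * y \<in> P"
    using assms by (auto simp: extended_ideal_def)
  have "(m * n) * (x + y) = n * (m * x) + m * (n * y)" by (simp add: algebra_simps)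
  then have "(m * n) * (x + y) \<in> P" using m n P_mult P_add by simp
  then show ?thesis
    using m n mult_closed A.units_mult by (auto simp: extended_ideal_def)
qed

lemma extended_mult:
  assumes "a \<in> A" "x \<in> extended_ideal R A P"
  shows "a * x \<in> extended_ideal R A P"
proof -
  obtain m n where m: "m \<in> R" "m \<in> units_of_subring A" "m * x \<in> P"
    and n: "n \<in> R" "n \<in> units_of_subring A" "n * a \<in> R"
    using assms denominator[OF assms(1)] by (auto simp: extended_ideal_def)
  have "(m * n) * (a * x) = (n * a) * (m * x)" by (simp add: algebra_simps)
  then have "(m * n) * (a * x) \<in> P" using m n P_mult by metis
  then show ?thesis
    using m n mult_closed A.units_mult by (auto simp: extended_ideal_def)
qed

lemma extended_prime:
  assumes "a \<in> A" "b \<in> A" "a * b \<in> extended_ideal R A P"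
  shows "a \<in> extended_ideal R A P \<or> b \<in> extended_ideal R A P"
proof -
  obtain k m n where k: "k \<in> R" "k \<in> units_of_subring A" "k * (a * b) \<in> P"
    and m: "m \<in> R" "m \<in> units_of_subring A" "m * a \<in> R"
    and n: "n \<in> R" "n \<in> units_of_subring A" "n * b \<in> R"
    using assms denominator[OF assms(1)] denominator[OF assms(2)] by (auto simp: extended_ideal_def)
  have "k * ((m * a) * (n * b)) = (m * n) * (k * (a * b))" by (simp add: algebra_simps)
  then have "k * ((m * a) * (n * b)) \<in> P" using k m n P_mult mult_closed by metis
  then have "m * a \<in> P \<or> n * b \<in> P"
    using P_prime k m n mult_closed unit_free by blast
  then show ?thesis using m n by (auto simp: extended_ideal_def)
qed

end

text \<open>P is extended to A, carried to A' and contracted to R'. With \<Psi> the inverse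
  isomorphism, the image in A' is written as a preimage.\<close>

definition transported_ideal ::
  "'a::field set \<Rightarrow> 'a set \<Rightarrow> 'b set \<Rightarrow> ('b::field \<Rightarrow> 'a) \<Rightarrow> 'a set \<Rightarrow> 'b set" where
  "transported_ideal R A R' \<Psi> P = {t \<in> R'. \<Psi> t \<in> extended_ideal R A P}"

text \<open>Both directions are parameters, so that \<open>swap\<close> reverses every result. They
  are maps of the whole fields, and the isomorphism of A with A' is the condition
  \<open>\<Phi>_A\<close>.\<close>

locale isomorphic_extensions =
  L: fraction_extension R A + L': fraction_extension R' A'
  for R A :: "'a::field set" and R' A' :: "'b::field set" +
  fixes \<Phi> :: "'a \<Rightarrow> 'b" and \<Psi> :: "'b \<Rightarrow> 'a"
  assumes \<Psi>_\<Phi> [simp]: "\<And>x. \<Psi> (\<Phi> x) = x" and \<Phi>_\<Psi> [simp]: "\<And>y. \<Phi> (\<Psi> y) = y"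
    and \<Phi>_mult: "\<And>x y. \<Phi> (x * y) = \<Phi> x * \<Phi> y"
    and \<Phi>_add: "\<And>x y. \<Phi> (x + y) = \<Phi> x + \<Phi> y"
    and \<Phi>_A: "\<And>x. \<Phi> x \<in> A' \<longleftrightarrow> x \<in> A"
begin

lemma \<Phi>_eq_iff: "\<Phi> x = \<Phi> y \<longleftrightarrow> x = y"
  by (metis \<Psi>_\<Phi>)

lemma \<Phi>_zero [simp]: "\<Phi> 0 = 0"
  using \<Phi>_add[of 0 0] by (simp only: add_0_right add_cancel_right_right)

lemma \<Phi>_one [simp]: "\<Phi> 1 = 1"
  using \<Phi>_mult[of 1 1] \<Phi>_eq_iff[of 1 0] by simp

lemma swap: "isomorphic_extensions R' A' R A \<Psi> \<Phi>"
proof unfold_locales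
  show "\<Psi> (x * y) = \<Psi> x * \<Psi> y" for x y
    by (metis \<Phi>_\<Psi> \<Psi>_\<Phi> \<Phi>_mult)
  show "\<Psi> (x + y) = \<Psi> x + \<Psi> y" for x y
    by (metis \<Phi>_\<Psi> \<Psi>_\<Phi> \<Phi>_add)
  show "\<Psi> x \<in> A \<longleftrightarrow> x \<in> A'" for x
    by (metis \<Phi>_\<Psi> \<Phi>_A)
qed simp_all

lemma \<Phi>_units:
  assumes "u \<in> units_of_subring A"
  shows "\<Phi> u \<in> units_of_subring A'"
proof -
  have "\<Phi> u * \<Phi> (inverse u) = 1"
    using assms by (simp add: \<Phi>_mult[symmetric] units_of_subring_def)
  then have "inverse (\<Phi> u) = \<Phi> (inverse u)" "\<Phi> u \<noteq> 0"
    by (auto intro: inverse_unique)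
  then show ?thesis using assms by (simp add: units_of_subring_def \<Phi>_A)
qed

lemma transported_zero: "transported_ideal R A R' \<Psi> {0} = {0}"
proof -
  have "t = 0" if "\<Psi> t = 0" for t using that \<Phi>_zero \<Phi>_\<Psi> by metis
  moreover have "\<Psi> 0 = 0" using \<Psi>_\<Phi>[of 0] by simp
  moreover have "1 \<in> R \<inter> units_of_subring A" by (simp add: units_of_subring_def)
  then have "extended_ideal R A {0} = {0}"
    by (auto simp: extended_ideal_def units_of_subring_def intro: exI[of _ 1])
  ultimately show ?thesis
    by (auto simp: transported_ideal_def)
qed

lemma transported_prime:
  assumes "unit_free_prime R A P"
  shows "unit_free_prime R' A' (transported_ideal R A R' \<Psi> P)" (is "unit_free_prime _ _ ?T")
proof -
  interpret unit_free_prime R A P by fact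
  interpret S: isomorphic_extensions R' A' R A \<Psi> \<Phi> by (rule swap)
  have \<Psi>_R': "\<Psi> r \<in> A" if "r \<in> R'" for r
    using that L'.R_subset_A S.\<Phi>_A by auto
  have "prime_ideal_in R' ?T"
    unfolding prime_ideal_in_def
  proof (intro conjI ballI impI)
    show "0 \<in> ?T"
      using P_extended P_zero by (auto simp: transported_ideal_def)
    show "1 \<notin> ?T"
      using extended_one by (auto simp: transported_ideal_def)
  next
    fix a b assume "a \<in> R'" "b \<in> R'" "a * b \<in> ?T"
    then show "a \<in> ?T \<or> b \<in> ?T"
      using extended_prime \<Psi>_R' by (auto simp: transported_ideal_def S.\<Phi>_mult)
  qed (auto simp: transported_ideal_def S.\<Phi>_mult S.\<Phi>_add extended_add extended_mult \<Psi>_R'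
         L'.add_closed L'.mult_closed)
  moreover have "?T \<inter> units_of_subring A' = {}"
  proof (rule ccontr)
    assume "?T \<inter> units_of_subring A' \<noteq> {}"
    then obtain t where t: "\<Psi> t \<in> extended_ideal R A P" "t \<in> units_of_subring A'"
      by (auto simp: transported_ideal_def)
    have "\<Psi> t \<in> units_of_subring A" using t S.\<Phi>_units by simp
    then have "inverse (\<Psi> t) * \<Psi> t \<in> extended_ideal R A P" "\<Psi> t \<noteq> 0"
      using t extended_mult by (auto simp: units_of_subring_def simp del: left_inverse)
    then show False using extended_one by simp
  qed
  ultimately show ?thesis by unfold_locales
qed

text \<open>Passing through R' introduces only denominators that are units of A'. Their images under
  \<Psi> are units of A and cancel in the extended ideal, and contracting the extension of a prime
  without units returns that prime.\<close>

lemma transported_transported: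
  assumes "unit_free_prime R A P"
  shows "transported_ideal R' A' R \<Phi> (transported_ideal R A R' \<Psi> P) = P"
proof -
  interpret unit_free_prime R A P by fact
  interpret S: isomorphic_extensions R' A' R A \<Psi> \<Phi> by (rule swap)
  show ?thesis
  proof (intro equalityI subsetI)
    fix r assume r: "r \<in> P"
    then have "\<Phi> r \<in> A'" using P_subset L.R_subset_A \<Phi>_A by auto
    then obtain m where m: "m \<in> R'" "m \<in> units_of_subring A'" "m * \<Phi> r \<in> R'"
      using L'.denominator by auto
    have "\<Psi> m * r \<in> extended_ideal R A P"
      using r P_extended m L'.R_subset_A S.\<Phi>_A by (intro extended_mult) auto
    then show "r \<in> transported_ideal R' A' R \<Phi> (transported_ideal R A R' \<Psi> P)"
      unfolding transported_ideal_def extended_ideal_def[of R'] using m r P_subset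
      by (auto simp: S.\<Phi>_mult)
  next
    fix r assume "r \<in> transported_ideal R' A' R \<Phi> (transported_ideal R A R' \<Psi> P)"
    then obtain m where r: "r \<in> R" and m: "m \<in> R'" "m \<in> units_of_subring A'"
      "\<Psi> m * r \<in> extended_ideal R A P"
      by (auto simp: transported_ideal_def extended_ideal_def[of R'] S.\<Phi>_mult)
    have "\<Psi> m \<in> units_of_subring A" using m S.\<Phi>_units by simp
    then have "inverse (\<Psi> m) \<in> A" "\<Psi> m \<noteq> 0" by (auto simp: units_of_subring_def)
    then have "inverse (\<Psi> m) * (\<Psi> m * r) \<in> extended_ideal R A P"
      using m extended_mult by blast
    then have "r \<in> extended_ideal R A P"
      using \<open>\<Psi> m \<noteq> 0\<close> by (simp add: mult.assoc[symmetric])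
    then show "r \<in> P" using extended_contract r by simp
  qed
qed

text \<open>Transport is monotone with a monotone inverse. A prime below one without units also has
  none, so a prime strictly below the transported one comes back to a prime strictly below
  P.\<close>

lemma transported_height_one:
  assumes P: "unit_free_prime R A P" and h: "height_one_prime R P"
  shows "height_one_prime R' (transported_ideal R A R' \<Psi> P)" (is "height_one_prime _ ?T")
proof -
  interpret S: isomorphic_extensions R' A' R A \<Psi> \<Phi> by (rule swap)
  interpret T: unit_free_prime R' A' ?T by (rule transported_prime[OF P])
  show ?thesis
    unfolding height_one_prime_def
  proof (intro conjI allI impI T.prime; (elim conjE)?)
    show "?T \<noteq> {0}"
      using transported_transported[OF P] S.transported_zero h by (auto simp: height_one_prime_def)
    fix Q assume Q: "prime_ideal_in R' Q" and QT: "Q \<subset> ?T"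
    have uQ: "unit_free_prime R' A' Q"
      using Q QT T.unit_free by unfold_locales auto
    let ?Q = "transported_ideal R' A' R \<Phi> Q"
    interpret Q': unit_free_prime R A ?Q by (rule S.transported_prime[OF uQ])
    have QQ: "transported_ideal R A R' \<Psi> ?Q = Q" by (rule S.transported_transported[OF uQ])
    have "?Q \<subseteq> transported_ideal R' A' R \<Phi> ?T"
      using QT by (auto simp: transported_ideal_def extended_ideal_def)
    then have "?Q \<subseteq> P" by (simp add: transported_transported[OF P])
    moreover have "?Q \<noteq> P" using QQ QT by auto
    ultimately have "?Q = {0}"
      using h Q'.prime unfolding height_one_prime_def by blast
    then show "Q = {0}" using QQ transported_zero by simp
  qed
qed

text \<open>This is how related variables meet the transport: the unit factor u by which they differ
  can be divided out.\<close>

lemma mem_transported: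
  assumes "unit_free_prime R A P" "x \<in> P" "y \<in> R'" "u \<in> units_of_subring A'" "\<Phi> x = y * u"
  shows "y \<in> transported_ideal R A R' \<Psi> P"
proof -
  interpret unit_free_prime R A P by fact
  interpret S: isomorphic_extensions R' A' R A \<Psi> \<Phi> by (rule swap)
  have "y = inverse u * \<Phi> x" using assms by (auto simp: units_of_subring_def)
  then have "\<Psi> y = \<Psi> (inverse u) * x" by (simp add: S.\<Phi>_mult)
  moreover have "\<Psi> (inverse u) \<in> A" using assms S.\<Phi>_A by (auto simp: units_of_subring_def)
  ultimately show ?thesis
    using assms P_extended extended_mult by (auto simp: transported_ideal_def)
qed

end

lemma ring_iso_isomorphic_extensions:
  assumes "fraction_extension R A" "fraction_extension R' A'"
    and amb: "\<Phi> \<in> ring_iso ambient ambient" and loc: "\<Phi> \<in> ring_iso (as_ring A) (as_ring A')"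
  shows "isomorphic_extensions R A R' A' \<Phi> (inv_into UNIV \<Phi>)"
proof -
  interpret L: fraction_extension R A by fact
  interpret L': fraction_extension R' A' by fact
  have bij: "bij \<Phi>" using amb by (simp add: ring_iso_def)
  have "\<Phi> ` A = A'" using loc by (simp add: ring_iso_def bij_betw_def)
  then have A: "\<Phi> x \<in> A' \<longleftrightarrow> x \<in> A" for x
    using bij by (metis bij_is_inj inj_image_mem_iff)
  show ?thesis
    using amb A bij
    by unfold_locales
      (auto simp: ring_iso_def ring_hom_def bij_is_inj bij_is_surj surj_f_inv_f)
qed

subsection \<open>Clusters at a height one prime\<close>

lemma algebraically_independent_nonzero:
  assumes "algebraically_independent n x" "i \<in> {1..n}"
  shows "x i \<noteq> 0"
proof
  assume "x i = 0"
  \<comment> \<open>The polynomial consisting of the single variable with index i.\<close>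
  define p :: "(nat \<Rightarrow>\<^sub>0 nat) \<Rightarrow>\<^sub>0 int" where
    "p = Poly_Mapping.single (Poly_Mapping.single i 1) 1"
  have "(\<Prod>j\<in>{1..n}. x j ^ Poly_Mapping.lookup (Poly_Mapping.single i 1) j) = 0"
    using assms(2) \<open>x i = 0\<close> by (intro prod_zero) (auto intro!: bexI[of _ i])
  then have "p = 0"
    using assms(1)[unfolded algebraically_independent_def, rule_format, of p] assms(2)
    by (simp add: p_def)
  then show False by (simp add: p_def)
qed

lemma variable_nonzero:
  "extended_seed \<Sigma> \<Longrightarrow> i \<in> {1..num_vars \<Sigma>} \<Longrightarrow> variable \<Sigma> i \<noteq> 0"
  using algebraically_independent_nonzero by (auto simp: extended_seed_def)

lemma rank_le_num_vars: "i \<in> {1..rank \<Sigma>} \<Longrightarrow> i \<in> {1..num_vars \<Sigma>}"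
  by (simp add: num_vars_def)

lemma admissible_all_iff:
  "admissible R \<Sigma> {1..num_vars \<Sigma>} \<longleftrightarrow>
     (\<forall>i\<in>{1..num_vars \<Sigma>}. variable \<Sigma> i \<in> R) \<and>
     (\<forall>i\<in>{1..rank \<Sigma>}. \<forall>j\<in>{1..rank \<Sigma>}. i \<noteq> j \<longrightarrow> coprime_in R (variable \<Sigma> i) (variable \<Sigma> j)) \<and>
     (\<forall>i\<in>{1..rank \<Sigma>}. mutated_var \<Sigma> i \<in> R \<and> coprime_in R (mutated_var \<Sigma> i) (variable \<Sigma> i))"
proof -
  have "{1..num_vars \<Sigma>} \<inter> {1..rank \<Sigma>} = {1..rank \<Sigma>}" by (auto simp: num_vars_def)
  then show ?thesis by (simp only: admissible_def) blast
qed

text \<open>Stated for any subring containing the variables, because it serves both R and the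
  ambient field.\<close>

lemma (in field_subring) exchange_polynomial_closed:
  assumes "variable \<Sigma> ` {1..num_vars \<Sigma>} \<subseteq> R"
  shows "\<exists>f\<in>R. mutated_var \<Sigma> k = f / variable \<Sigma> k"
proof -
  have "(\<Prod>j\<in>{j\<in>{1..num_vars \<Sigma>}. P j}. variable \<Sigma> j ^ e j) \<in> R" for P and e :: "nat \<Rightarrow> nat"
    using assms by (intro prod_closed power_closed) blast
  from bexI[OF refl add_closed[OF this this]] show ?thesis
    unfolding mutated_var_def .
qed

lemma ambient_field_subring: "field_subring (ambient_field \<Sigma>)"
  unfolding ambient_field_def
  by (intro field_subring.intro subfieldE(1)[of _ ambient]
        field.generate_field_is_subfield[OF field_ambient]) simp

lemma variable_in_ambient_field:
  "i \<in> {1..num_vars \<Sigma>} \<Longrightarrow> variable \<Sigma> i \<in> ambient_field \<Sigma>"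
  unfolding ambient_field_def by (auto intro: generate_field.incl)

text \<open>The isomorphism of fraction fields is known to agree with the quasi-isomorphism only on
  the ambient field, so mutations have to be located there before the two can be compared.\<close>

lemma mutated_var_in_ambient_field:
  assumes "k \<in> {1..num_vars \<Sigma>}"
  shows "mutated_var \<Sigma> k \<in> ambient_field \<Sigma>"
proof -
  interpret field_subring "ambient_field \<Sigma>" by (rule ambient_field_subring)
  have inverse: "inverse x \<in> ambient_field \<Sigma>" if "x \<in> ambient_field \<Sigma>" for x
    using generate_field.m_inv[of x ambient] that unfolding ambient_field_def
    by (cases "x = 0") auto
  obtain f where f: "f \<in> ambient_field \<Sigma>" "mutated_var \<Sigma> k = f / variable \<Sigma> k"
    using exchange_polynomial_closed variable_in_ambient_field by blast
  show ?thesis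
    unfolding f(2) divide_inverse
    using f inverse variable_in_ambient_field[OF assms] mult_closed by blast
qed

lemma initial_seed_in_cluster_structure: "\<Sigma> \<in> cluster_structure \<Sigma>"
  by (auto simp: cluster_structure_def mutations_def intro!: exI[of _ "[]"])

lemma mutate_in_cluster_structure:
  "k \<in> {1..rank \<Sigma>} \<Longrightarrow> mutate k \<Sigma> \<in> cluster_structure \<Sigma>"
  by (auto simp: cluster_structure_def mutations_def intro!: exI[of _ "[k]"])

text \<open>Frozen variables may lie in P, as the Laurent ring inverts cluster variables
  only.\<close>

lemma (in prime_of_subring) laurent_ring_local:
  assumes "variable \<Sigma> ` {1..num_vars \<Sigma>} \<subseteq> R" "variable \<Sigma> ` {1..rank \<Sigma>} \<inter> P = {}"
  shows "laurent_ring \<Sigma> \<subseteq> local_ring_at R P"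
  unfolding laurent_ring_def
proof (rule generate_subset_local_ring, intro Un_least image_subsetI)
  fix i assume "i \<in> {1..num_vars \<Sigma>}"
  then show "variable \<Sigma> i \<in> local_ring_at R P" using assms(1) subset_local_ring by blast
next
  fix i assume "i \<in> {1..rank \<Sigma>}"
  then show "inverse (variable \<Sigma> i) \<in> local_ring_at R P"
    using assms rank_le_num_vars by (intro inverse_in_local_ring) blast
qed

text \<open>
  A height one prime contains at most one initial cluster variable \<open>x\<close>. If there is one, it does
  not contain \<open>x'\<close>, so all cluster variables of the adjacent cluster are units in the local ring.
\<close>

lemma upper_cluster_algebra_regular:
  assumes normal: "normal_noetherian_domain R" and adm: "admissible R \<Sigma> {1..num_vars \<Sigma>}"
  shows "upper_cluster_algebra \<Sigma> \<subseteq> R"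
proof
  interpret normal_domain R
    using normal by (intro normal_domain.intro field_subring.intro normal_domain_axioms.intro)
      (auto simp: normal_noetherian_domain_def domain_with_fraction_field_def)
  have vars: "variable \<Sigma> ` {1..num_vars \<Sigma>} \<subseteq> R"
    and coprime: "\<And>i j. i \<in> {1..rank \<Sigma>} \<Longrightarrow> j \<in> {1..rank \<Sigma>} \<Longrightarrow> i \<noteq> j \<Longrightarrow>
      coprime_in R (variable \<Sigma> i) (variable \<Sigma> j)"
    and mutated: "\<And>i. i \<in> {1..rank \<Sigma>} \<Longrightarrow> mutated_var \<Sigma> i \<in> R"
      "\<And>i. i \<in> {1..rank \<Sigma>} \<Longrightarrow> coprime_in R (mutated_var \<Sigma> i) (variable \<Sigma> i)"
    using adm unfolding admissible_all_iff by blast+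
  fix z assume z: "z \<in> upper_cluster_algebra \<Sigma>"
  show "z \<in> R"
  proof (rule in_all_local_rings)
    fix P assume P: "height_one_prime R P"
    interpret P: prime_of_subring R P
      using P by unfold_locales (simp add: height_one_prime_def)
    show "z \<in> local_ring_at R P"
    proof (cases "\<exists>k\<in>{1..rank \<Sigma>}. variable \<Sigma> k \<in> P")
      case False
      then have "laurent_ring \<Sigma> \<subseteq> local_ring_at R P"
        using vars by (intro P.laurent_ring_local) auto
      then show ?thesis
        using z initial_seed_in_cluster_structure by (auto simp: upper_cluster_algebra_def)
    next
      case True
      then obtain k where k: "k \<in> {1..rank \<Sigma>}" "variable \<Sigma> k \<in> P" by blast
      have "laurent_ring (mutate k \<Sigma>) \<subseteq> local_ring_at R P"
      proof (rule P.laurent_ring_local)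
        show "variable (mutate k \<Sigma>) ` {1..num_vars (mutate k \<Sigma>)} \<subseteq> R"
          using vars mutated(1)[OF k(1)] by (auto simp: mutate_def num_vars_def)
        have "mutated_var \<Sigma> k \<notin> P"
          using mutated(2)[OF k(1)] k P unfolding coprime_in_iff by blast
        moreover have "variable \<Sigma> i \<notin> P" if "i \<in> {1..rank \<Sigma>}" "i \<noteq> k" for i
          using coprime[OF that(1) k(1) that(2)] k P unfolding coprime_in_iff by blast
        ultimately show "variable (mutate k \<Sigma>) ` {1..rank (mutate k \<Sigma>)} \<inter> P = {}"
          by (auto simp: mutate_def)
      qed
      then show ?thesis
        using z mutate_in_cluster_structure[OF k(1)] by (auto simp: upper_cluster_algebra_def)
    qed
  qed
qed

text \<open>
  At a height one prime without marked variables, everything is read off from the corresponding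
  prime of \<open>R'\<close>, where related variables differ by units.
\<close>

lemma local_admissibility:
  assumes R: "subring R ambient" and R': "subring R' ambient"
    and seeds: "extended_seed \<Sigma>" "extended_seed \<Sigma>'"
    and triple: "related_triple \<Sigma> \<Sigma>' \<kappa>"
    and bqi: "birational_quasi_isomorphism \<Sigma> R \<Sigma>' R' \<kappa> Q"
    and adm: "admissible R' \<Sigma>' {1..num_vars \<Sigma>'}"
    and vars: "variable \<Sigma> ` {1..num_vars \<Sigma>} \<subseteq> R"
    and P: "height_one_prime R P"
    and unmarked: "variable \<Sigma> ` source_marked \<Sigma> \<Sigma>' \<kappa> \<inter> P = {}"
    and i: "i \<in> {1..rank \<Sigma>}"
  shows "mutated_var \<Sigma> i \<in> local_ring_at R P"
    and "variable \<Sigma> i \<in> P \<Longrightarrow> mutated_var \<Sigma> i \<notin> P"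
    and "j \<in> {1..rank \<Sigma>} \<Longrightarrow> i \<noteq> j \<Longrightarrow> variable \<Sigma> i \<in> P \<Longrightarrow> variable \<Sigma> j \<notin> P"
proof -
  interpret field_subring R by (rule field_subring.intro) (rule R)
  interpret R': field_subring R' by (rule field_subring.intro) (rule R')
  interpret P: prime_of_subring R P
    using P by unfold_locales (simp add: height_one_prime_def)
  let ?I = "source_marked \<Sigma> \<Sigma>' \<kappa>" and ?J = "target_marked \<Sigma> \<Sigma>' \<kappa>"
  let ?S = "variable \<Sigma> ` ?I" and ?S' = "variable \<Sigma>' ` ?J"
  let ?A = "localization R ?S" and ?A' = "localization R' ?S'"
  have nums: "num_vars \<Sigma>' = num_vars \<Sigma>" and inj: "inj_on \<kappa> {1..num_vars \<Sigma>}"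
    and \<kappa>: "\<kappa> ` {1..num_vars \<Sigma>} = {1..num_vars \<Sigma>}"
    using triple by (auto simp: related_triple_def marker_def bij_betw_def)
  have I: "?I \<subseteq> {1..num_vars \<Sigma>}" "\<kappa> ` ?I \<subseteq> ?J" by (auto simp: source_marked_def)
  have J: "?J \<subseteq> {1..num_vars \<Sigma>'}" by (auto simp: target_marked_def)
  \<comment> \<open>A cluster variable whose counterpart is frozen is marked by definition, so
    unmarked ones correspond to cluster variables, to which admissibility of the target
    applies.\<close>
  have \<kappa>_rank: "\<kappa> k \<in> {1..rank \<Sigma>'}" if "k \<in> {1..rank \<Sigma>}" "k \<notin> ?I" for k
  proof -
    have k: "k \<in> {1..num_vars \<Sigma>}" using that rank_le_num_vars by blast
    then have "\<kappa> k \<notin> ?J" using that by (simp add: source_marked_def)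
    moreover have "\<kappa> k \<in> {1..num_vars \<Sigma>'}" using k \<kappa> nums by auto
    ultimately show ?thesis using that by (auto simp: target_marked_def)
  qed
  obtain \<Phi> where \<Phi>: "\<Phi> \<in> ring_iso ambient ambient" "\<Phi> \<in> ring_iso (as_ring ?A) (as_ring ?A')"
    and \<Phi>_Q: "\<And>z. z \<in> ambient_field \<Sigma> \<Longrightarrow> \<Phi> z = Q z"
    and S: "?S \<subseteq> R" "?S' \<subseteq> R'" and quasi: "quasi_isomorphism \<Sigma> \<Sigma>' \<kappa> Q"
    using bqi by (auto simp: birational_quasi_isomorphism_def)
  have S0: "0 \<notin> ?S" using variable_nonzero[OF seeds(1)] I(1) by force
  have S'0: "0 \<notin> ?S'" using variable_nonzero[OF seeds(2)] J by force
  let ?\<Psi> = "inv_into UNIV \<Phi>"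
  interpret E: isomorphic_extensions R ?A R' ?A' \<Phi> ?\<Psi>
    by (rule ring_iso_isomorphic_extensions[OF fraction_extension_localization[OF R S(1) S0]
          fraction_extension_localization[OF R' S(2) S'0] \<Phi>])
  \<comment> \<open>This serves two purposes: P contains no unit of \<open>?A\<close>, so it can be
    transported, and whatever is shown to lie in \<open>?A\<close> is regular at P.\<close>
  have A_local: "?A \<subseteq> local_ring_at R P"
    unfolding localization_def
  proof (rule P.generate_subset_local_ring, intro Un_least image_subsetI P.subset_local_ring)
    fix s assume "s \<in> ?S"
    then show "inverse s \<in> local_ring_at R P" using S(1) unmarked by (intro P.inverse_in_local_ring) blast
  qed
  have "P \<inter> units_of_subring ?A = {}"
  proof (rule ccontr)
    assume "P \<inter> units_of_subring ?A \<noteq> {}"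
    then obtain u where u: "u \<in> P" "u \<noteq> 0" "inverse u \<in> ?A" by (auto simp: units_of_subring_def)
    then obtain s where s: "s \<in> R" "s \<notin> P" "s * inverse u \<in> R"
      using A_local by (auto simp: local_ring_at_def)
    have "(s * inverse u) * u \<in> P" using s u P.P_mult by blast
    then show False using s u by (simp add: mult.assoc)
  qed
  then interpret U: unit_free_prime R ?A P by unfold_locales
  let ?T = "transported_ideal R ?A R' ?\<Psi> P"
  have T: "height_one_prime R' ?T"
    by (rule E.transported_height_one[OF U.unit_free_prime_axioms P])
  \<comment> \<open>Applied to the empty sequence for the variables and to a single mutation for the
    mutated variables. Under \<open>fixed\<close>, the monomial in the marked variables is a unit of
    \<open>?A'\<close>.\<close>
  have related: "\<exists>u\<in>units_of_subring ?A'.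
      \<Phi> (variable (mutations ks \<Sigma>) k) = variable (mutations (map \<kappa> ks) \<Sigma>') (\<kappa> k) * u"
    if ks: "set ks \<subseteq> {1..rank \<Sigma>} - ?I" and k: "k \<in> {1..num_vars \<Sigma>} - ?I"
      and amb: "variable (mutations ks \<Sigma>) k \<in> ambient_field \<Sigma>"
      and fixed: "\<And>j. j \<in> ?J \<Longrightarrow> variable (mutations (map \<kappa> ks) \<Sigma>') j = variable \<Sigma>' j" for ks k
  proof -
    let ?y = "variable (mutations (map \<kappa> ks) \<Sigma>')"
    obtain lam :: "nat \<Rightarrow> nat \<Rightarrow> int" where lam:
      "Q (variable (mutations ks \<Sigma>) k) = ?y (\<kappa> k) * (\<Prod>j\<in>?I. ?y (\<kappa> j) powi lam k j)"
      using quasi ks k unfolding quasi_isomorphism_def Let_def by blast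
    have "(\<Prod>j\<in>?I. ?y (\<kappa> j) powi lam k j) \<in> units_of_subring ?A'"
    proof (intro E.L'.A.units_prod E.L'.A.units_powi)
      fix j assume "j \<in> ?I"
      then have "\<kappa> j \<in> ?J" using I by blast
      then show "?y (\<kappa> j) \<in> units_of_subring ?A'"
        using fixed localization_units[OF _ S(2) S'0] by simp
    qed
    then show ?thesis using lam \<Phi>_Q[OF amb] by auto
  qed
  have var_related: "\<exists>u\<in>units_of_subring ?A'. \<Phi> (variable \<Sigma> k) = variable \<Sigma>' (\<kappa> k) * u"
    if "k \<in> {1..num_vars \<Sigma>} - ?I" for k
    using related[of "[]" k] that variable_in_ambient_field[of k \<Sigma>] by (simp add: mutations_def)
  have mut_related: "\<exists>u\<in>units_of_subring ?A'. \<Phi> (mutated_var \<Sigma> k) = mutated_var \<Sigma>' (\<kappa> k) * u"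
    if k: "k \<in> {1..rank \<Sigma>}" "k \<notin> ?I" for k
  proof -
    have "\<kappa> k \<notin> ?J" using \<kappa>_rank[OF k] by (simp add: target_marked_def)
    then have fixed: "variable (mutations (map \<kappa> [k]) \<Sigma>') j = variable \<Sigma>' j" if "j \<in> ?J" for j
      using that by (auto simp: mutations_def mutate_def)
    have y: "variable (mutations [k] \<Sigma>) k = mutated_var \<Sigma> k"
      "variable (mutations (map \<kappa> [k]) \<Sigma>') (\<kappa> k) = mutated_var \<Sigma>' (\<kappa> k)"
      by (simp_all add: mutations_def mutate_def)
    have "set [k] \<subseteq> {1..rank \<Sigma>} - ?I" "k \<in> {1..num_vars \<Sigma>} - ?I"
      using k rank_le_num_vars[OF k(1)] by auto
    from related[OF this _ fixed] show ?thesis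
      unfolding y using mutated_var_in_ambient_field[OF rank_le_num_vars[OF k(1)]] by blast
  qed
  have in_T: "variable \<Sigma>' (\<kappa> k) \<in> ?T" if "k \<in> {1..rank \<Sigma>}" "variable \<Sigma> k \<in> P" "k \<notin> ?I" for k
  proof -
    have "variable \<Sigma>' (\<kappa> k) \<in> R'"
      using adm \<kappa>_rank that rank_le_num_vars[of "\<kappa> k" \<Sigma>'] unfolding admissible_all_iff by blast
    then show ?thesis
      using var_related[of k] that E.mem_transported[OF U.unit_free_prime_axioms] rank_le_num_vars
      by blast
  qed
  \<comment> \<open>The claims about variables in P thus concern unmarked indices only; regularity
    of the mutation needs a case distinction.\<close>
  have not_marked: "k \<notin> ?I" if "variable \<Sigma> k \<in> P" for k using unmarked that by blast
  have mut: "mutated_var \<Sigma>' (\<kappa> k) \<in> R'" "coprime_in R' (mutated_var \<Sigma>' (\<kappa> k)) (variable \<Sigma>' (\<kappa> k))"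
    if "k \<in> {1..rank \<Sigma>}" "k \<notin> ?I" for k
    using adm \<kappa>_rank[OF that] unfolding admissible_all_iff by blast+
  show "mutated_var \<Sigma> i \<in> local_ring_at R P"
  proof (cases "i \<in> ?I")
    \<comment> \<open>The related seeds do not include mutation in a marked direction. But a marked
      variable is a unit at P, and the exchange polynomial f is regular because all of x_0
      is.\<close>
    case True
    obtain f where f: "f \<in> R" "mutated_var \<Sigma> i = f * inverse (variable \<Sigma> i)"
      using exchange_polynomial_closed[OF vars] by (auto simp: divide_inverse)
    interpret L: field_subring "local_ring_at R P"
      by (rule field_subring.intro) (rule P.local_ring_subring)
    have "inverse (variable \<Sigma> i) \<in> local_ring_at R P"
      using True unmarked S(1) by (intro P.inverse_in_local_ring) blast
    then show ?thesis unfolding f(2) using f(1) P.subset_local_ring L.mult_closed by blast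
  next
    case False
    then obtain u where u: "u \<in> units_of_subring ?A'"
      "\<Phi> (mutated_var \<Sigma> i) = mutated_var \<Sigma>' (\<kappa> i) * u"
      using mut_related i by blast
    then have "\<Phi> (mutated_var \<Sigma> i) \<in> ?A'"
      using mut(1)[OF i False] E.L'.R_subset_A E.L'.A.mult_closed by (auto simp: units_of_subring_def)
    then show ?thesis using E.\<Phi>_A A_local by blast
  qed
  show "mutated_var \<Sigma> i \<notin> P" if x: "variable \<Sigma> i \<in> P"
  proof
    assume "mutated_var \<Sigma> i \<in> P"
    then have "mutated_var \<Sigma>' (\<kappa> i) \<in> ?T"
      using mut_related[OF i not_marked[OF x]] mut(1)[OF i not_marked[OF x]]
        E.mem_transported[OF U.unit_free_prime_axioms] by blast
    then show False
      using in_T[OF i x not_marked[OF x]] mut(2)[OF i not_marked[OF x]] T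
      unfolding R'.coprime_in_iff by blast
  qed
  show "variable \<Sigma> j \<notin> P" if j: "j \<in> {1..rank \<Sigma>}" and ij: "i \<noteq> j" and x: "variable \<Sigma> i \<in> P"
  proof
    assume y: "variable \<Sigma> j \<in> P"
    have "\<kappa> i \<noteq> \<kappa> j"
      using inj_onD[OF inj _ rank_le_num_vars[OF i] rank_le_num_vars[OF j]] ij by blast
    then have "coprime_in R' (variable \<Sigma>' (\<kappa> i)) (variable \<Sigma>' (\<kappa> j))"
      using adm \<kappa>_rank[OF i not_marked[OF x]] \<kappa>_rank[OF j not_marked[OF y]]
      unfolding admissible_all_iff by blast
    then show False
      using in_T[OF i x not_marked[OF x]] in_T[OF j y not_marked[OF y]] T
      unfolding R'.coprime_in_iff by blast
  qed
qed

theorem proposition4p3: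
  fixes R :: "'a::field set" and R\<^sub>t :: "'b::field set" and R\<^sub>h :: "'c::field set"
    and \<Sigma> :: "'a ext_seed" and \<Sigma>\<^sub>t :: "'b ext_seed" and \<Sigma>\<^sub>h :: "'c ext_seed"
    and \<kappa> \<kappa>' :: "nat \<Rightarrow> nat" and Q :: "'a \<Rightarrow> 'b" and Q' :: "'a \<Rightarrow> 'c"
  assumes "normal_noetherian_domain R"
    and "normal_noetherian_domain R\<^sub>t"
    and "normal_noetherian_domain R\<^sub>h"
    and "extended_seed \<Sigma>" and "extended_seed \<Sigma>\<^sub>t" and "extended_seed \<Sigma>\<^sub>h"
    and "related_triple \<Sigma> \<Sigma>\<^sub>t \<kappa>"
    and "related_triple \<Sigma> \<Sigma>\<^sub>h \<kappa>'"
    and "birational_quasi_isomorphism \<Sigma> R \<Sigma>\<^sub>t R\<^sub>t \<kappa> Q"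
    and "birational_quasi_isomorphism \<Sigma> R \<Sigma>\<^sub>h R\<^sub>h \<kappa>' Q'"
    and "source_marked \<Sigma> \<Sigma>\<^sub>t \<kappa> \<inter> source_marked \<Sigma> \<Sigma>\<^sub>h \<kappa>' = {}"
    and "admissible R\<^sub>t \<Sigma>\<^sub>t {1..num_vars \<Sigma>\<^sub>t}"
    and "admissible R\<^sub>h \<Sigma>\<^sub>h {1..num_vars \<Sigma>\<^sub>h}"
    and "\<forall>i\<in>source_marked \<Sigma> \<Sigma>\<^sub>t \<kappa>. \<forall>j\<in>source_marked \<Sigma> \<Sigma>\<^sub>h \<kappa>'. coprime_in R (variable \<Sigma> i) (variable \<Sigma> j)"
    and "\<forall>i\<in>{1..num_vars \<Sigma>}. variable \<Sigma> i \<in> R"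
  shows "admissible R \<Sigma> {1..num_vars \<Sigma>} \<and>
         upper_cluster_algebra \<Sigma>\<^sub>h \<subseteq> R\<^sub>h \<and>
         upper_cluster_algebra \<Sigma>\<^sub>t \<subseteq> R\<^sub>t \<and>
         upper_cluster_algebra \<Sigma> \<subseteq> R"
proof -
  have sub: "subring R ambient" "subring R\<^sub>t ambient" "subring R\<^sub>h ambient"
    using assms(1-3) by (auto simp: normal_noetherian_domain_def domain_with_fraction_field_def)
  interpret normal_domain R
    using assms(1) sub(1) by (intro normal_domain.intro field_subring.intro normal_domain_axioms.intro)
  have vars: "variable \<Sigma> ` {1..num_vars \<Sigma>} \<subseteq> R" using assms(15) by blast
  \<comment> \<open>Which quasi-isomorphism is usable depends on P, so the local claims are stated
    without reference to either.\<close>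
  have local: "mutated_var \<Sigma> i \<in> local_ring_at R P \<and>
      (variable \<Sigma> i \<in> P \<longrightarrow> mutated_var \<Sigma> i \<notin> P) \<and>
      (\<forall>j\<in>{1..rank \<Sigma>}. i \<noteq> j \<longrightarrow> variable \<Sigma> i \<in> P \<longrightarrow> variable \<Sigma> j \<notin> P)"
    if P: "height_one_prime R P" and i: "i \<in> {1..rank \<Sigma>}" for P i
  proof -
    consider "variable \<Sigma> ` source_marked \<Sigma> \<Sigma>\<^sub>t \<kappa> \<inter> P = {}"
      | "variable \<Sigma> ` source_marked \<Sigma> \<Sigma>\<^sub>h \<kappa>' \<inter> P = {}"
      using assms(14) P unfolding coprime_in_iff by blast
    then show ?thesis
    proof cases
      case 1
      from local_admissibility[OF sub(1,2) assms(4,5,7,9,12) vars P 1 i] show ?thesis by blast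
    next
      case 2
      from local_admissibility[OF sub(1,3) assms(4,6,8,10,13) vars P 2 i] show ?thesis by blast
    qed
  qed
  have mutated: "mutated_var \<Sigma> i \<in> R" if "i \<in> {1..rank \<Sigma>}" for i
    using local that by (intro in_all_local_rings) blast
  have "admissible R \<Sigma> {1..num_vars \<Sigma>}"
    unfolding admissible_all_iff coprime_in_iff
    using assms(15) mutated local rank_le_num_vars[of _ \<Sigma>] by blast
  then show ?thesis
    using upper_cluster_algebra_regular[OF assms(1)] upper_cluster_algebra_regular[OF assms(2,12)]
      upper_cluster_algebra_regular[OF assms(3,13)] by blast
qed

end
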